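(* Let $X$ be a linearly ordered set with $|X|\geq 5$. Then there exists no transitive binary relation $\succeq$ on $\mathcal{X}=2^X\setminus\{\emptyset\}$ satisfying the first axiom of the Gärdenfors principle (GF1), bottom independence (botIND) as well as top independence (topIND), and simple uncertainty aversion (SUAv).
   Context: $X$ is linearly ordered by $\dot{\geq}$ (reflexive, complete, transitive, antisymmetric), with strict part $x\mathrel{\dot{>}}y$ iff $x\mathrel{\dot{\geq}}y$ and not $y\mathrel{\dot{\geq}}x$. $\mathcal{X}=2^X\setminus\{\emptyset\}$ is the set of nonempty subsets of $X$. For a binary relation $\succeq$ on $\mathcal{X}$, $A\succ B$ means $A\succeq B$ and not $B\succeq A$. The axioms are: - (GF1) for all $x\in X$, $A\in\mathcal{X}$: if $x\mathrel{\dot{>}}a$ for all $a\in A$, then $A\cup\{x\}\succ A$. - (botIND) for all $A,B\in\mathcal{X}$ and all $x\in X\setminus(A\cup B)$ such that $y\mathrel{\dot{>}}x$ for all $y\in A\cup B$: $A\succ B$ implies $A\cup\{x\}\succeq B\cup\{x\}$. - (topIND) for all $A,B\in\mathcal{X}$ and all $x\in X\setminus(A\cup B)$ such that $x\mathrel{\dot{>}}y$ for all $y\in A\cup B$: $A\succ B$ implies $A\cup\{x\}\succeq B\cup\{x\}$. - (SUAv) for all $x,y,z\in X$: $x\mathrel{\dot{>}}y$ and $y\mathrel{\dot{>}}z$ imply $\{y\}\succ\{x,z\}$. *)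

theory Defs
  imports Main
begin

definition nonempty_subsets :: "'a set \<Rightarrow> 'a set set" where
  "nonempty_subsets X = Pow X - {{}}"

(* Relations are read as "greater than or equal": a pair (x, y) in R says that x is
   weakly above y. This is the converse of the usual reading of pairs in the
   library's order predicates, which are themselves invariant under converse. *)
definition strict_part :: "'b rel \<Rightarrow> 'b \<Rightarrow> 'b \<Rightarrow> bool" where
  "strict_part R x y \<longleftrightarrow> (x, y) \<in> R \<and> (y, x) \<notin> R"

(* In the axioms, G is the linear order on X and W the relation on nonempty subsets. *)

definition GF1 :: "'a set \<Rightarrow> 'a rel \<Rightarrow> 'a set rel \<Rightarrow> bool" where
  "GF1 X G W \<longleftrightarrow>
    (\<forall>x\<in>X. \<forall>A\<in>nonempty_subsets X.
      (\<forall>a\<in>A. strict_part G x a) \<longrightarrow> strict_part W (A \<union> {x}) A)"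

definition botIND :: "'a set \<Rightarrow> 'a rel \<Rightarrow> 'a set rel \<Rightarrow> bool" where
  "botIND X G W \<longleftrightarrow>
    (\<forall>A\<in>nonempty_subsets X. \<forall>B\<in>nonempty_subsets X. \<forall>x\<in>X - (A \<union> B).
      (\<forall>y\<in>A \<union> B. strict_part G y x) \<longrightarrow>
      strict_part W A B \<longrightarrow> (A \<union> {x}, B \<union> {x}) \<in> W)"

definition topIND :: "'a set \<Rightarrow> 'a rel \<Rightarrow> 'a set rel \<Rightarrow> bool" where
  "topIND X G W \<longleftrightarrow>
    (\<forall>A\<in>nonempty_subsets X. \<forall>B\<in>nonempty_subsets X. \<forall>x\<in>X - (A \<union> B).
      (\<forall>y\<in>A \<union> B. strict_part G x y) \<longrightarrow>
      strict_part W A B \<longrightarrow> (A \<union> {x}, B \<union> {x}) \<in> W)"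

definition SUAv :: "'a set \<Rightarrow> 'a rel \<Rightarrow> 'a set rel \<Rightarrow> bool" where
  "SUAv X G W \<longleftrightarrow>
    (\<forall>x\<in>X. \<forall>y\<in>X. \<forall>z\<in>X.
      strict_part G x y \<longrightarrow> strict_part G y z \<longrightarrow> strict_part W {y} {x, z})"

end

(* For a < b < c < d < e, independence turns {c} > {b,d}, {a,b} > {a} and {d} > {c,e}
   into the chain {a,c} >= {a,b,d} >= {a,d} >= {a,c,e}, whereas GF1 puts {a,c,e} strictly
   above {a,c}. *)
theory Submission
  imports Defs
begin

text \<open>Take five points \<open>a < b < c < d < e\<close> and keep \<open>a\<close> at the
  bottom of every set. Uncertainty aversion then allows \<open>c\<close> to be exchanged for the
  surrounding pair \<open>b\<close>, \<open>d\<close> without improvement. In the presence of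
  \<open>a\<close> and \<open>d\<close>, dropping \<open>b\<close> is no improvement either, since
  \<open>b\<close> only raises \<open>{a}\<close>. Exchanging the remaining \<open>d\<close> for
  \<open>c\<close>, \<open>e\<close> turns \<open>{a, c}\<close> into \<open>{a, c, e}\<close>, so
  adding a new top element was no improvement, which GF1 forbids. Independence returns only weak
  comparisons, but transitivity chains these, and the final clash needs strictness only from GF1.
  \<open>strict_chain_of_five\<close> supplies the points.\<close>

lemma finite_has_least:
  assumes "linear_order_on X G" and "finite F" and "F \<noteq> {}" and "F \<subseteq> X"
  shows "\<exists>m\<in>F. \<forall>y\<in>F - {m}. strict_part G y m"
  using assms(2-4)
proof (induction F rule: finite_ne_induct)
  case (singleton x)
  then show ?case by simp
next
  case (insert x F)
  have tot: "\<And>u v. u \<in> X \<Longrightarrow> v \<in> X \<Longrightarrow> u \<noteq> v \<Longrightarrow> (u, v) \<in> G \<or> (v, u) \<in> G"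
    and anti: "\<And>u v. (u, v) \<in> G \<Longrightarrow> (v, u) \<in> G \<Longrightarrow> u = v"
    and tr: "\<And>u v w. (u, v) \<in> G \<Longrightarrow> (v, w) \<in> G \<Longrightarrow> (u, w) \<in> G"
    using assms(1)
    unfolding linear_order_on_def partial_order_on_def preorder_on_def total_on_def
    by (blast, meson antisymD, meson transD)
  from insert obtain m where m: "m \<in> F" "\<forall>y\<in>F - {m}. strict_part G y m" by auto
  have "x \<noteq> m" "x \<in> X" "m \<in> X" using m insert by auto
  then consider "(x, m) \<in> G" | "(m, x) \<in> G" using tot by blast
  then show ?case
  proof cases
    case 1
    then have "strict_part G x m" using anti \<open>x \<noteq> m\<close> by (auto simp: strict_part_def)
    then show ?thesis using m by auto
  next
    \<comment> \<open>The new point lies below the old least element \<open>m\<close>, so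
      transitivity through \<open>m\<close> puts it below all of \<open>F\<close>; for y = m the
      case assumption itself suffices.\<close>
    case 2
    have "strict_part G y x" if "y \<in> F" for y
    proof -
      have "(y, m) \<in> G" if "y \<noteq> m" using m \<open>y \<in> F\<close> that by (auto simp: strict_part_def)
      then have "(y, x) \<in> G" using 2 tr by blast
      then show ?thesis using anti that \<open>x \<notin> F\<close> by (auto simp: strict_part_def)
    qed
    then show ?thesis by auto
  qed
qed

text \<open>The successor form of the cardinality lets the split be iterated on what remains after
  removing \<open>m\<close>.\<close>

lemma finite_split_least:
  assumes "linear_order_on X G" and "F \<subseteq> X" and "card F = Suc n"
  obtains m where "m \<in> F" and "\<forall>y\<in>F - {m}. strict_part G y m" and "card (F - {m}) = n"
proof -
  have "finite F" "F \<noteq> {}" using assms(3) by (auto intro: card_ge_0_finite)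
  then obtain m where "m \<in> F" "\<forall>y\<in>F - {m}. strict_part G y m"
    using finite_has_least assms by metis
  then show ?thesis using that assms(3) by simp
qed

text \<open>Least elements are peeled off a five-element subset one after another; each lies below
  everything still present, hence below all points chosen later. The disjunction is there because
  \<open>card\<close> is 0 on infinite sets.\<close>

lemma strict_chain_of_five:
  assumes "linear_order_on X G" and "infinite X \<or> card X \<ge> 5"
  obtains a b c d e where "{a, b, c, d, e} \<subseteq> X"
    and "\<forall>y\<in>{b, c, d, e}. strict_part G y a" and "\<forall>y\<in>{c, d, e}. strict_part G y b"
    and "\<forall>y\<in>{d, e}. strict_part G y c" and "strict_part G e d"
proof -
  have "\<exists>F. F \<subseteq> X \<and> card F = 5"
  proof (cases "finite X")
    case True
    then have "5 \<le> card X" using assms(2) by simp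
    then show ?thesis by (metis obtain_subset_with_card_n)
  next
    case False
    then show ?thesis using infinite_arbitrarily_large by blast
  qed
  then obtain F where F: "F \<subseteq> X" "card F = Suc (Suc (Suc (Suc (Suc 0))))"
    by (auto simp: eval_nat_numeral)
  obtain a where a: "a \<in> F" "\<forall>y\<in>F - {a}. strict_part G y a"
    "card (F - {a}) = Suc (Suc (Suc (Suc 0)))"
    using finite_split_least[OF assms(1) F] .
  have "F - {a} \<subseteq> X" using F(1) by blast
  from finite_split_least[OF assms(1) this a(3)]
  obtain b where b: "b \<in> F - {a}" "\<forall>y\<in>F - {a} - {b}. strict_part G y b"
    "card (F - {a} - {b}) = Suc (Suc (Suc 0))" .
  have "F - {a} - {b} \<subseteq> X" using F(1) by blast
  from finite_split_least[OF assms(1) this b(3)]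
  obtain c where c: "c \<in> F - {a} - {b}" "\<forall>y\<in>F - {a} - {b} - {c}. strict_part G y c"
    "card (F - {a} - {b} - {c}) = Suc (Suc 0)" .
  have "F - {a} - {b} - {c} \<subseteq> X" using F(1) by blast
  from finite_split_least[OF assms(1) this c(3)]
  obtain d where d: "d \<in> F - {a} - {b} - {c}"
    "\<forall>y\<in>F - {a} - {b} - {c} - {d}. strict_part G y d"
    "card (F - {a} - {b} - {c} - {d}) = Suc 0" .
  from d(3) obtain e where "F - {a} - {b} - {c} - {d} = {e}"
    by (auto simp: card_Suc_eq)
  then have e: "e \<in> F - {a} - {b} - {c} - {d}" by simp
  show ?thesis
  proof (rule that)
    show "{a, b, c, d, e} \<subseteq> X" using a(1) b(1) c(1) d(1) e F(1) by auto
  qed (use a(2) b(1,2) c(1,2) d(1,2) e in simp_all)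
qed

theorem theorem6:
  fixes X :: "'a set" and G :: "'a rel"
  assumes "linear_order_on X G"
    and "infinite X \<or> card X \<ge> 5"
  shows "\<not> (\<exists>W. W \<subseteq> nonempty_subsets X \<times> nonempty_subsets X \<and> trans W \<and>
    GF1 X G W \<and> botIND X G W \<and> topIND X G W \<and> SUAv X G W)"
proof
  assume "\<exists>W. W \<subseteq> nonempty_subsets X \<times> nonempty_subsets X \<and> trans W \<and>
    GF1 X G W \<and> botIND X G W \<and> topIND X G W \<and> SUAv X G W"
  then obtain W where tr: "trans W" and gf: "GF1 X G W" and bot: "botIND X G W"
    and top: "topIND X G W" and sua: "SUAv X G W" by blast
  obtain a b c d e where X: "{a, b, c, d, e} \<subseteq> X"
    and lt: "\<forall>y\<in>{b, c, d, e}. strict_part G y a" "\<forall>y\<in>{c, d, e}. strict_part G y b"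
      "\<forall>y\<in>{d, e}. strict_part G y c" "strict_part G e d"
    using strict_chain_of_five[OF assms] .
  have neq: "y \<noteq> x" if "strict_part G y x" for x y
    using that by (auto simp: strict_part_def)
  \<comment> \<open>These inequalities discharge the freshness condition on the point added by the
    independence axioms.\<close>
  have ne: "b \<noteq> a" "c \<noteq> a" "d \<noteq> a" "e \<noteq> a" "c \<noteq> b" "d \<noteq> b" "d \<noteq> c" "e \<noteq> c"
    using lt by (auto dest: neq)
  have gfD: "strict_part W (A \<union> {x}) A"
    if "x \<in> X" "A \<subseteq> X" "A \<noteq> {}" "\<forall>y\<in>A. strict_part G x y" for A x
    using gf that unfolding GF1_def nonempty_subsets_def by blast
  have botD: "(A \<union> {x}, B \<union> {x}) \<in> W"
    if "strict_part W A B" "A \<subseteq> X" "A \<noteq> {}" "B \<subseteq> X" "B \<noteq> {}" "x \<in> X"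
      "x \<notin> A \<union> B" "\<forall>y\<in>A \<union> B. strict_part G y x" for A B x
    using bot that unfolding botIND_def nonempty_subsets_def by blast
  have topD: "(A \<union> {x}, B \<union> {x}) \<in> W"
    if "strict_part W A B" "A \<subseteq> X" "A \<noteq> {}" "B \<subseteq> X" "B \<noteq> {}" "x \<in> X"
      "x \<notin> A \<union> B" "\<forall>y\<in>A \<union> B. strict_part G x y" for A B x
    using top that unfolding topIND_def nonempty_subsets_def by blast
  have suaD: "strict_part W {y} {x, z}"
    if "x \<in> X" "y \<in> X" "z \<in> X" "strict_part G x y" "strict_part G y z" for x y z
    using sua that unfolding SUAv_def by blast
  \<comment> \<open>\<open>c\<close> lies between \<open>b\<close> and \<open>d\<close>, and
    \<open>a\<close> lies below all three, so bottom independence may add it to both sides.\<close>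
  have "strict_part W {c} {d, b}"
    by (rule suaD) (use X lt in simp_all)
  then have "({c} \<union> {a}, {d, b} \<union> {a}) \<in> W"
    by (rule botD) (use X lt ne in auto)
  moreover have "strict_part W {d} {e, c}"
    by (rule suaD) (use X lt in simp_all)
  then have "({d} \<union> {a}, {e, c} \<union> {a}) \<in> W"
    by (rule botD) (use X lt ne in auto)
  \<comment> \<open>This is the link that discards \<open>b\<close>: GF1 compares the sets without
    \<open>d\<close>, and top independence then adds \<open>d\<close> to both.\<close>
  moreover have "strict_part W ({a} \<union> {b}) {a}"
    by (rule gfD) (use X lt in auto)
  then have "({a} \<union> {b} \<union> {d}, {a} \<union> {d}) \<in> W"
    by (rule topD) (use X lt ne in auto)
  ultimately have "({a, c}, {a, b, d}) \<in> W" "({a, b, d}, {a, d}) \<in> W" "({a, d}, {a, c, e}) \<in> W"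
    by (simp_all add: insert_commute)
  then have "({a, c}, {a, c, e}) \<in> W" using tr by (meson transD)
  \<comment> \<open>\<open>e\<close> exceeds \<open>a\<close> and \<open>c\<close>, so the
    strictness in GF1 excludes exactly the pair just derived.\<close>
  moreover have "strict_part W ({a, c} \<union> {e}) {a, c}"
    by (rule gfD) (use X lt in auto)
  ultimately show False by (simp add: strict_part_def insert_commute)
qed

end
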